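(* Let $m\ge 1$ be an integer, $a,b,d\in\mathbb{R}$, and let $f:\mathbb{C}\to\mathbb{C}$, $f(z)=(a+bz\bar z)z+d\,\bar z^{\,m-1}$. Let $q\in(0,1)$ and let $z_0=x(0)+iy(0)$ with $x(0),y(0)\in\mathbb{R}$ and $y(0)\neq 0$. Then the fractional-order map of order $q$ associated with $f$ and the initial value $z_0$ has no dihedral ($D_m$) symmetry.
   Context: The fractional-order (FO) variant of $f$ is given by the Caputo discrete initial value problem $\Delta_*^q z(t)=f(z(t+q-1))$, $t\in\{1-q,2-q,\dots\}$, $z(0)=z_0$, whose solution satisfies $z(n)=\Phi_n(z)$ for $n\ge 1$. Here, for the fixed initial value $z_0$ and any sequence $z=(z(0),z(1),z(2),\dots)$ of complex numbers, $$\Phi_n(z)=z_0+\frac{1}{\Gamma(q)}\sum_{k=1}^n\frac{\Gamma(n-k+q)}{\Gamma(n-k+1)}f(z(k-1)),\qquad n=1,2,3,\dots$$ Let $R_1(w)=\mathrm{e}^{2\pi i/m}w$ (rotation by $2\pi/m$) and $S_0(w)=\bar w$ (reflection across the real axis), the generators of the dihedral group $D_m$; they act on sequences termwise, $(\sigma z)(n)=\sigma(z(n))$. The FO map associated with $f$ and $z_0$ is equivariant with respect to $\sigma$ if $\Phi_n(\sigma z)=\sigma(\Phi_n(z))$ for all $n\ge 1$ and all complex sequences $z$, where the additive term $z_0$ in $\Phi_n$ is kept fixed. It has dihedral symmetry if it is equivariant with respect to both $R_1$ and $S_0$. For $m=1$ the term $\bar z^{\,m-1}$ is the constant $1$. 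*)

theory Defs
  imports "HOL-Analysis.Gamma_Function"
begin

text \<open>
  The right-hand side of the solution formula of the Caputo discrete initial value problem
  \<open>\<Delta>\<^sub>*\<^sup>q z(t) = f (z (t + q - 1))\<close>, \<open>z(0) = z\<^sub>0\<close>, applied to an arbitrary sequence \<open>z\<close>.
  It is meant for \<open>n \<ge> 1\<close>.
\<close>
definition fo_map :: "(complex \<Rightarrow> complex) \<Rightarrow> real \<Rightarrow> complex \<Rightarrow> (nat \<Rightarrow> complex) \<Rightarrow> nat \<Rightarrow> complex"
  where "fo_map f q z0 z n =
    z0 + of_real (1 / Gamma q) *
      (\<Sum>k=1..n. of_real (Gamma (real n - real k + q) / Gamma (real n - real k + 1)) * f (z (k - 1)))"

text \<open>The additive term \<open>z0\<close> is not transformed by \<open>\<sigma>\<close>: the same \<open>z0\<close> occurs on both sides.\<close>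
definition fo_equivariant :: "(complex \<Rightarrow> complex) \<Rightarrow> real \<Rightarrow> complex \<Rightarrow> (complex \<Rightarrow> complex) \<Rightarrow> bool"
  where "fo_equivariant f q z0 \<sigma> \<longleftrightarrow>
    (\<forall>n\<ge>1. \<forall>z :: nat \<Rightarrow> complex. fo_map f q z0 (\<lambda>j. \<sigma> (z j)) n = \<sigma> (fo_map f q z0 z n))"

definition dihedral_rotation :: "nat \<Rightarrow> complex \<Rightarrow> complex"
  where "dihedral_rotation m w = exp (2 * of_real pi * \<i> / of_nat m) * w"

definition dihedral_reflection :: "complex \<Rightarrow> complex"
  where "dihedral_reflection w = cnj w"

definition fo_dihedral_symmetric :: "nat \<Rightarrow> (complex \<Rightarrow> complex) \<Rightarrow> real \<Rightarrow> complex \<Rightarrow> bool"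
  where "fo_dihedral_symmetric m f q z0 \<longleftrightarrow>
    fo_equivariant f q z0 (dihedral_rotation m) \<and> fo_equivariant f q z0 dihedral_reflection"

end

theory Submission imports Defs begin

text \<open>The additive term \<open>z0\<close> stays fixed while the reflection conjugates
  everything else. If \<open>f\<close> commutes with conjugation at a single point, equivariance at
  \<open>n = 1\<close> already forces \<open>z0 = cnj z0\<close>, which \<open>y0 \<noteq> 0\<close>
  excludes.\<close>

lemma fo_equivariant_reflection_imp_real_initial_value:
  assumes eq: "fo_equivariant f q z0 dihedral_reflection"
    and comm: "f (cnj w) = cnj (f w)"
  shows "z0 \<in> \<real>"
proof -
  have "fo_map f q z0 (\<lambda>_. cnj w) 1 = cnj (fo_map f q z0 (\<lambda>_. w) 1)"
    using eq by (simp add: fo_equivariant_def dihedral_reflection_def)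
  \<comment> \<open>For \<open>n = 1\<close> only the summand \<open>k = 1\<close> remains. Its
    weight is real, so by \<open>comm\<close> the \<open>f\<close>-terms on both sides agree and
    cancel.\<close>
  then have "cnj z0 = z0"
    by (simp add: fo_map_def comm split: if_splits)
  then show ?thesis
    by (simp add: Reals_cnj_iff)
qed

theorem theorem5:
  fixes m :: nat and a b d q x0 y0 :: real and f :: "complex \<Rightarrow> complex" and z0 :: complex
  assumes "m \<ge> 1"
    and "\<And>z. f z = (of_real a + of_real b * z * cnj z) * z + of_real d * cnj z ^ (m - 1)"
    and "0 < q" and "q < 1"
    and "z0 = of_real x0 + \<i> * of_real y0"
    and "y0 \<noteq> 0"
  shows "\<not> fo_dihedral_symmetric m f q z0"
proof
  assume "fo_dihedral_symmetric m f q z0"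
  then have "fo_equivariant f q z0 dihedral_reflection"
    by (simp add: fo_dihedral_symmetric_def)
  \<comment> \<open>The witness 0 is convenient: \<open>f 0\<close> is \<open>d\<close> if
    \<open>m = 1\<close> and 0 if \<open>m > 1\<close>, real in both cases.\<close>
  moreover have "f (cnj 0) = cnj (f 0)"
    by (simp add: assms(2))
  ultimately have "z0 \<in> \<real>"
    by (rule fo_equivariant_reflection_imp_real_initial_value)
  with assms(5,6) show False
    by (simp add: complex_is_Real_iff)
qed

end
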